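(* Let $\Lambda$ be a row-finite $k$-graph. Suppose that $x\in\partial\Lambda\setminus\Lambda^{\le\infty}$ and $m\le n\in\mathbb N^k$. Then there exists $y\in\Lambda^{\le\infty}$ such that $(x;(m,n))\sim(y;(m,n))$.
   Context: Conventions: $\mathbb N=\{0,1,2,\dots\}$; $e_1,\dots,e_k$ are the standard generators of $\mathbb N^k$; $(\mathbb N\cup\{\infty\})^k$ is ordered coordinatewise; $\wedge,\vee$ are coordinatewise minimum and maximum. A $k$-graph is a countable category $\Lambda$ with a functor $d:\Lambda\to\mathbb N^k$ (degree) satisfying the factorisation property: whenever $d(\lambda)=m+n$ there are unique $\mu,\nu$ with $\lambda=\mu\nu$, $d(\mu)=m$, $d(\nu)=n$. $\lambda\in\Lambda$ means $\lambda$ is a morphism (path), $r,s$ are codomain and domain ($\lambda\mu$ is defined iff $s(\lambda)=r(\mu)$). $\Lambda^n=d^{-1}(n)$; $\Lambda^0$ is identified with the objects (vertices); $vF=\{\lambda\in F:r(\lambda)=v\}$. A $k$-graph morphism is a degree-preserving functor. $\Lambda$ is row-finite if $v\Lambda^n$ is finite for all $v\in\Lambda^0$, $n\in\mathbb N^k$. For $m\in(\mathbb N\cup\{\infty\})^k$, $\Omega_{k,m}$ is the $k$-graph with objects $p\in\mathbb N^k$, $p\le m$, morphisms $(p,q)$ with $p\le q\le m$, $r(p,q)=p$, $s(p,q)=q$, $d(p,q)=q-p$, $(p,q)(q,t)=(p,t)$. $\Lambda^m$ also denotes the set of $k$-graph morphisms $x:\Omega_{k,m}\to\Lambda$, with $d(x):=m$,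 $x(n):=x(n,n)$; for $m\in\mathbb N^k$ these are identified with the paths of degree $m$ ($\lambda(p,q)$ being the unique middle factor $\lambda''$ of $\lambda=\lambda'\lambda''\lambda'''$ with $d(\lambda')=p$, $d(\lambda'')=q-p$). $W_\Lambda=\bigcup_m\Lambda^m$ is the path space. $\mathrm{MCE}(\mu,\nu)$ is the set of $\lambda\in\Lambda$ with $\lambda=\mu\alpha=\nu\beta$ for some $\alpha,\beta$ and $d(\lambda)=d(\mu)\vee d(\nu)$. $E\subset v\Lambda$ is exhaustive if for every $\mu\in v\Lambda$ there is $\lambda\in E$ with $\mathrm{MCE}(\lambda,\mu)\neq\emptyset$; $v\mathcal{FE}(\Lambda)$ is the set of finite exhaustive subsets of $v\Lambda$. $x\in W_\Lambda$ is a boundary path, written $x\in\partial\Lambda$, if for all $n\in\mathbb N^k$ with $n\le d(x)$ and all $E\in x(n)\mathcal{FE}(\Lambda)$ there is $m\in\mathbb N^k$ ($n\le m\le d(x)$) with $x(n,m)\in E$. $\Lambda^{\le\infty}$ is the set of $x\in W_\Lambda$ for which there exists $n_x\in\mathbb N^k$, $n_x\le d(x)$, such that whenever $n\in\mathbb N^k$ and $i\le k$ satisfy $n_x\le n\le d(x)$ and $n_i=d(x)_i$, we have $x(n)\Lambda^{e_i}=\emptyset$. (One has $\Lambda^{\le\infty}\subset\partial\Lambda$.) For $x,y\in\partial\Lambda$ and $m\le n$, $p\le q$ in $\mathbb N^k$, $(x;(m,n))\sim(y;(p,q))$ means: $x(m\wedge d(x),n\wedge d(x))=y(p\wedge d(y),q\wedge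 d(y))$, $m-m\wedge d(x)=p-p\wedge d(y)$, and $n-m=q-p$. *)

theory Defs
  imports Complex_Main "HOL-Library.Countable_Set" "HOL-Library.Extended_Nat"
    "HOL-Library.Function_Algebras" "HOL-Library.FuncSet"
begin

section \<open>Degrees\<close>

text \<open>
  A finite type \<open>'k\<close> indexes the coordinates: \<open>'k \<Rightarrow> nat\<close> is the monoid of degrees
  and \<open>'k \<Rightarrow> enat\<close> its extension by infinite entries.  Sums, differences, order, \<open>inf\<close> and
  \<open>sup\<close> of such functions are pointwise.
\<close>

definition emb :: "('k \<Rightarrow> nat) \<Rightarrow> ('k \<Rightarrow> enat)" where
  "emb n = (\<lambda>i. enat (n i))"

definition unit_deg :: "'k \<Rightarrow> ('k \<Rightarrow> nat)" where
  "unit_deg i = (\<lambda>j. if j = i then 1 else 0)"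

text \<open>The coordinatewise minimum of \<open>n\<close> and \<open>m\<close>, as a finite degree; see \<open>emb_meet\<close>.\<close>

definition meet :: "('k \<Rightarrow> nat) \<Rightarrow> ('k \<Rightarrow> enat) \<Rightarrow> ('k \<Rightarrow> nat)" where
  "meet n m = (\<lambda>i. the_enat (min (enat (n i)) (m i)))"

lemma emb_meet: "emb (meet n m) = inf (emb n) m"
proof
  fix i show "emb (meet n m) i = inf (emb n) m i"
    by (cases "m i") (simp_all add: emb_def meet_def inf_fun_def inf_min)
qed


section \<open>Categories and functors\<close>

text \<open>
  \<open>Rng\<close> and \<open>Src\<close> are codomain and domain, and \<open>f \<cdot> g\<close> is the composite of \<open>f\<close> after \<open>g\<close>,
  meaningful when \<open>Src f = Rng g\<close>.
\<close>

record ('o, 'm) cat =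
  Obj :: "'o set"
  Mor :: "'m set"
  Rng :: "'m \<Rightarrow> 'o"
  Src :: "'m \<Rightarrow> 'o"
  Idn :: "'o \<Rightarrow> 'm"
  Cmp :: "'m \<Rightarrow> 'm \<Rightarrow> 'm"  (infixl "\<cdot>\<index>" 70)

locale category =
  fixes C :: "('o, 'm, 'z) cat_scheme" (structure)
  assumes Rng_closed: "f \<in> Mor C \<Longrightarrow> Rng C f \<in> Obj C"
    and Src_closed: "f \<in> Mor C \<Longrightarrow> Src C f \<in> Obj C"
    and Idn_closed: "a \<in> Obj C \<Longrightarrow> Idn C a \<in> Mor C"
    and Rng_Idn: "a \<in> Obj C \<Longrightarrow> Rng C (Idn C a) = a"
    and Src_Idn: "a \<in> Obj C \<Longrightarrow> Src C (Idn C a) = a"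
    and Cmp_closed: "\<lbrakk>f \<in> Mor C; g \<in> Mor C; Src C f = Rng C g\<rbrakk> \<Longrightarrow> f \<cdot> g \<in> Mor C"
    and Rng_Cmp: "\<lbrakk>f \<in> Mor C; g \<in> Mor C; Src C f = Rng C g\<rbrakk> \<Longrightarrow> Rng C (f \<cdot> g) = Rng C f"
    and Src_Cmp: "\<lbrakk>f \<in> Mor C; g \<in> Mor C; Src C f = Rng C g\<rbrakk> \<Longrightarrow> Src C (f \<cdot> g) = Src C g"
    and Idn_left: "f \<in> Mor C \<Longrightarrow> Idn C (Rng C f) \<cdot> f = f"
    and Idn_right: "f \<in> Mor C \<Longrightarrow> f \<cdot> Idn C (Src C f) = f"
    and Cmp_assoc: "\<lbrakk>f \<in> Mor C; g \<in> Mor C; h \<in> Mor C; Src C f = Rng C g; Src C g = Rng C h\<rbrakk>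
        \<Longrightarrow> (f \<cdot> g) \<cdot> h = f \<cdot> (g \<cdot> h)"

text \<open>
  A functor is given by its object map \<open>F0\<close> and its morphism map \<open>F1\<close>, both made extensional so
  that functors are equal as soon as they agree on objects and morphisms.
\<close>

definition cat_functor ::
  "('o, 'm, 'y) cat_scheme \<Rightarrow> ('p, 'n, 'z) cat_scheme \<Rightarrow> ('o \<Rightarrow> 'p) \<Rightarrow> ('m \<Rightarrow> 'n) \<Rightarrow> bool" where
  "cat_functor C D F0 F1 \<longleftrightarrow>
     F0 \<in> Obj C \<rightarrow>\<^sub>E Obj D \<and> F1 \<in> Mor C \<rightarrow>\<^sub>E Mor D \<and>
     (\<forall>f\<in>Mor C. Rng D (F1 f) = F0 (Rng C f) \<and> Src D (F1 f) = F0 (Src C f)) \<and>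
     (\<forall>a\<in>Obj C. F1 (Idn C a) = Idn D (F0 a)) \<and>
     (\<forall>f\<in>Mor C. \<forall>g\<in>Mor C. Src C f = Rng C g \<longrightarrow> F1 (f \<cdot>\<^bsub>C\<^esub> g) = F1 f \<cdot>\<^bsub>D\<^esub> F1 g)"


section \<open>Higher-rank graphs\<close>

record ('o, 'm, 'k) graded_cat = "('o, 'm) cat" +
  deg :: "'m \<Rightarrow> 'k \<Rightarrow> nat"

text \<open>
  \<open>deg_Idn\<close> and \<open>deg_Cmp\<close> say that the degree is a functor to the monoid \<open>'k \<Rightarrow> nat\<close>, regarded as
  a category with one object.
\<close>

locale kgraph = category \<Lambda> for \<Lambda> :: "('o, 'm, 'k::finite) graded_cat" (structure) +
  assumes countable_Obj: "countable (Obj \<Lambda>)"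
    and countable_Mor: "countable (Mor \<Lambda>)"
    and deg_Idn: "v \<in> Obj \<Lambda> \<Longrightarrow> deg \<Lambda> (Idn \<Lambda> v) = 0"
    and deg_Cmp: "\<lbrakk>f \<in> Mor \<Lambda>; g \<in> Mor \<Lambda>; Src \<Lambda> f = Rng \<Lambda> g\<rbrakk>
        \<Longrightarrow> deg \<Lambda> (f \<cdot> g) = deg \<Lambda> f + deg \<Lambda> g"
    and factorisation: "\<lbrakk>l \<in> Mor \<Lambda>; deg \<Lambda> l = m + n\<rbrakk>
        \<Longrightarrow> \<exists>!(\<mu>, \<nu>). \<mu> \<in> Mor \<Lambda> \<and> \<nu> \<in> Mor \<Lambda> \<and> Src \<Lambda> \<mu> = Rng \<Lambda> \<nu> \<and>
              l = \<mu> \<cdot> \<nu> \<and> deg \<Lambda> \<mu> = m \<and> deg \<Lambda> \<nu> = n"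

text \<open>
  Vertices are kept as objects; the next lemma is their identification with the morphisms of
  degree 0.
\<close>

lemma (in kgraph) bij_betw_Idn: "bij_betw (Idn \<Lambda>) (Obj \<Lambda>) {f \<in> Mor \<Lambda>. deg \<Lambda> f = 0}"
proof (rule bij_betw_byWitness[where f' = "Rng \<Lambda>"])
  show "\<forall>a\<in>Obj \<Lambda>. Rng \<Lambda> (Idn \<Lambda> a) = a" by (simp add: Rng_Idn)
  show "\<forall>f\<in>{f \<in> Mor \<Lambda>. deg \<Lambda> f = 0}. Idn \<Lambda> (Rng \<Lambda> f) = f"
  proof safe
    fix f assume f: "f \<in> Mor \<Lambda>" "deg \<Lambda> f = 0"
    have "deg \<Lambda> f = 0 + 0" using f by simp
    from factorisation[OF f(1) this] obtain p where
      p: "\<And>\<mu> \<nu>. \<lbrakk>\<mu> \<in> Mor \<Lambda>; \<nu> \<in> Mor \<Lambda>; Src \<Lambda> \<mu> = Rng \<Lambda> \<nu>; f = \<mu> \<cdot> \<nu>; deg \<Lambda> \<mu> = 0; deg \<Lambda> \<nu> = 0\<rbrakk>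
        \<Longrightarrow> (\<mu>, \<nu>) = p"
      by (elim ex1E) (metis (mono_tags, lifting) case_prodI)
    have "(Idn \<Lambda> (Rng \<Lambda> f), f) = p"
      using f by (intro p) (auto simp: Rng_closed Idn_closed Src_Idn Idn_left deg_Idn)
    moreover have "(f, Idn \<Lambda> (Src \<Lambda> f)) = p"
      using f by (intro p) (auto simp: Src_closed Idn_closed Rng_Idn Idn_right deg_Idn)
    ultimately show "Idn \<Lambda> (Rng \<Lambda> f) = f" by auto
  qed
qed (auto simp: Idn_closed deg_Idn Rng_closed)

definition kgraph_morphism ::
  "('o, 'm, 'k::finite) graded_cat \<Rightarrow> ('p, 'n, 'k) graded_cat \<Rightarrow> ('o \<Rightarrow> 'p) \<Rightarrow> ('m \<Rightarrow> 'n) \<Rightarrow> bool" where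
  "kgraph_morphism \<Gamma> \<Lambda> F0 F1 \<longleftrightarrow>
     cat_functor \<Gamma> \<Lambda> F0 F1 \<and> (\<forall>f\<in>Mor \<Gamma>. deg \<Lambda> (F1 f) = deg \<Gamma> f)"

text \<open>The set of morphisms with range \<open>v\<close> and degree \<open>n\<close>.\<close>

definition paths_from :: "('o, 'm, 'k::finite) graded_cat \<Rightarrow> 'o \<Rightarrow> ('k \<Rightarrow> nat) \<Rightarrow> 'm set" where
  "paths_from \<Lambda> v n = {f \<in> Mor \<Lambda>. Rng \<Lambda> f = v \<and> deg \<Lambda> f = n}"

definition row_finite :: "('o, 'm, 'k::finite) graded_cat \<Rightarrow> bool" where
  "row_finite \<Lambda> \<longleftrightarrow> (\<forall>v\<in>Obj \<Lambda>. \<forall>n. finite (paths_from \<Lambda> v n))"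


section \<open>The path space\<close>

definition Omega ::
  "('k::finite \<Rightarrow> enat) \<Rightarrow> ('k \<Rightarrow> nat, ('k \<Rightarrow> nat) \<times> ('k \<Rightarrow> nat), 'k) graded_cat" where
  "Omega m =
     \<lparr>Obj = {p. emb p \<le> m},
      Mor = {(p, q). p \<le> q \<and> emb q \<le> m},
      Rng = fst,
      Src = snd,
      Idn = (\<lambda>p. (p, p)),
      Cmp = (\<lambda>f g. (fst f, snd g)),
      deg = (\<lambda>f. snd f - fst f)\<rparr>"

lemma kgraph_Omega: "kgraph (Omega m)"
proof
  show "countable (Obj (Omega m))" by (rule countableI_type)
  show "countable (Mor (Omega m))" by (rule countableI_type)
next
  fix l a b assume l: "l \<in> Mor (Omega m)" and ab: "deg (Omega m) l = a + b"
  obtain p q where pq: "l = (p, q)" "p \<le> q" "emb q \<le> m" using l by (auto simp: Omega_def)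
  have ab': "q i - p i = a i + b i" "p i \<le> q i" "enat (q i) \<le> m i" for i
    using fun_cong[OF ab, of i] pq by (auto simp: Omega_def emb_def le_fun_def)
  have q: "q = p + a + b"
  proof
    fix i show "q i = (p + a + b) i" using ab'(1,2)[of i] by simp
  qed
  have "enat (p i + a i) \<le> m i" for i
    using ab'[of i] by (intro order_trans[OF _ ab'(3)]) simp
  then have le: "emb (p + a) \<le> m" by (simp add: emb_def le_fun_def)
  show "\<exists>!(\<mu>, \<nu>). \<mu> \<in> Mor (Omega m) \<and> \<nu> \<in> Mor (Omega m) \<and> Src (Omega m) \<mu> = Rng (Omega m) \<nu> \<and>
          l = \<mu> \<cdot>\<^bsub>Omega m\<^esub> \<nu> \<and> deg (Omega m) \<mu> = a \<and> deg (Omega m) \<nu> = b"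
  proof (rule ex1I[of _ "((p, p + a), (p + a, q))"])
    show "case ((p, p + a), (p + a, q)) of (\<mu>, \<nu>) \<Rightarrow>
          \<mu> \<in> Mor (Omega m) \<and> \<nu> \<in> Mor (Omega m) \<and> Src (Omega m) \<mu> = Rng (Omega m) \<nu> \<and>
          l = \<mu> \<cdot>\<^bsub>Omega m\<^esub> \<nu> \<and> deg (Omega m) \<mu> = a \<and> deg (Omega m) \<nu> = b"
      using pq le by (auto simp: Omega_def q le_fun_def fun_eq_iff)
  next
    fix z assume "case z of (\<mu>, \<nu>) \<Rightarrow>
          \<mu> \<in> Mor (Omega m) \<and> \<nu> \<in> Mor (Omega m) \<and> Src (Omega m) \<mu> = Rng (Omega m) \<nu> \<and>
          l = \<mu> \<cdot>\<^bsub>Omega m\<^esub> \<nu> \<and> deg (Omega m) \<mu> = a \<and> deg (Omega m) \<nu> = b"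
    then obtain t where t: "z = ((p, t), (t, q))" "p \<le> t" "t - p = a"
      using pq by (auto simp: Omega_def)
    have "t i = p i + a i" for i
      using t(2) fun_cong[OF t(3), of i] le_funD[OF t(2), of i] by simp
    then have "t = p + a" by (auto simp: fun_eq_iff)
    then show "z = ((p, p + a), (p + a, q))" using t by simp
  qed
qed (auto simp: Omega_def emb_def le_fun_def fun_eq_iff,
  (meson enat_ord_simps(1) order_trans)+)

text \<open>
  A path \<open>x\<close> carries its degree \<open>d(x)\<close> together with the object map \<open>n \<mapsto> x(n)\<close> and the morphism
  map \<open>(p, q) \<mapsto> x(p, q)\<close> of a graph morphism defined on \<open>Omega (d(x))\<close>.
\<close>

record ('o, 'm, 'k) path =
  pdeg :: "'k \<Rightarrow> enat"
  vert :: "('k \<Rightarrow> nat) \<Rightarrow> 'o"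
  seg :: "('k \<Rightarrow> nat) \<times> ('k \<Rightarrow> nat) \<Rightarrow> 'm"

definition path_space :: "('o, 'm, 'k::finite) graded_cat \<Rightarrow> ('o, 'm, 'k) path set" where
  "path_space \<Lambda> = {x. kgraph_morphism (Omega (pdeg x)) \<Lambda> (vert x) (seg x)}"


section \<open>Boundary paths\<close>

definition MCE :: "('o, 'm, 'k::finite) graded_cat \<Rightarrow> 'm \<Rightarrow> 'm \<Rightarrow> 'm set" where
  "MCE \<Lambda> \<mu> \<nu> = {l \<in> Mor \<Lambda>.
     (\<exists>\<alpha>\<in>Mor \<Lambda>. Src \<Lambda> \<mu> = Rng \<Lambda> \<alpha> \<and> l = \<mu> \<cdot>\<^bsub>\<Lambda>\<^esub> \<alpha>) \<and>
     (\<exists>\<beta>\<in>Mor \<Lambda>. Src \<Lambda> \<nu> = Rng \<Lambda> \<beta> \<and> l = \<nu> \<cdot>\<^bsub>\<Lambda>\<^esub> \<beta>) \<and>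
     deg \<Lambda> l = sup (deg \<Lambda> \<mu>) (deg \<Lambda> \<nu>)}"

definition exhaustive :: "('o, 'm, 'k::finite) graded_cat \<Rightarrow> 'o \<Rightarrow> 'm set \<Rightarrow> bool" where
  "exhaustive \<Lambda> v E \<longleftrightarrow>
     E \<subseteq> {f \<in> Mor \<Lambda>. Rng \<Lambda> f = v} \<and>
     (\<forall>\<mu>\<in>Mor \<Lambda>. Rng \<Lambda> \<mu> = v \<longrightarrow> (\<exists>l\<in>E. MCE \<Lambda> l \<mu> \<noteq> {}))"

definition FE :: "('o, 'm, 'k::finite) graded_cat \<Rightarrow> 'o \<Rightarrow> 'm set set" where
  "FE \<Lambda> v = {E. finite E \<and> exhaustive \<Lambda> v E}"

definition boundary_paths :: "('o, 'm, 'k::finite) graded_cat \<Rightarrow> ('o, 'm, 'k) path set" where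
  "boundary_paths \<Lambda> = {x \<in> path_space \<Lambda>.
     \<forall>n. emb n \<le> pdeg x \<longrightarrow>
       (\<forall>E\<in>FE \<Lambda> (vert x n). \<exists>m. n \<le> m \<and> emb m \<le> pdeg x \<and> seg x (n, m) \<in> E)}"

definition le_infty_paths :: "('o, 'm, 'k::finite) graded_cat \<Rightarrow> ('o, 'm, 'k) path set" where
  "le_infty_paths \<Lambda> = {x \<in> path_space \<Lambda>.
     \<exists>n0. emb n0 \<le> pdeg x \<and>
       (\<forall>n i. n0 \<le> n \<and> emb n \<le> pdeg x \<and> enat (n i) = pdeg x i
          \<longrightarrow> paths_from \<Lambda> (vert x n) (unit_deg i) = {})}"

text \<open>
  The relation between triples \<open>(x; (m, n))\<close> and \<open>(y; (p, q))\<close>, defined only for boundary paths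
  \<open>x\<close>, \<open>y\<close> and degrees \<open>m \<le> n\<close>, \<open>p \<le> q\<close>.
\<close>

definition bpath_rel :: "('o, 'm, 'k::finite) graded_cat \<Rightarrow>
    ('o, 'm, 'k) path \<times> ('k \<Rightarrow> nat) \<times> ('k \<Rightarrow> nat) \<Rightarrow>
    ('o, 'm, 'k) path \<times> ('k \<Rightarrow> nat) \<times> ('k \<Rightarrow> nat) \<Rightarrow> bool" where
  "bpath_rel \<Lambda> = (\<lambda>(x, m, n) (y, p, q).
     x \<in> boundary_paths \<Lambda> \<and> y \<in> boundary_paths \<Lambda> \<and> m \<le> n \<and> p \<le> q \<and>
     seg x (meet m (pdeg x), meet n (pdeg x)) = seg y (meet p (pdeg y), meet q (pdeg y)) \<and>
     m - meet m (pdeg x) = p - meet p (pdeg y) \<and>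
     n - m = q - p)"

end

theory Submission
  imports Defs
begin

text \<open>
  Put \<open>p = n \<and> d(x)\<close> and let \<open>I\<close> be the set of coordinates \<open>i\<close> with \<open>d(x)\<^sub>i < n\<^sub>i\<close>.  The set of
  all edges from \<open>x(p)\<close> of degree \<open>e\<^sub>i\<close> with \<open>i \<in> I\<close> is finite by row-finiteness, and it is not
  exhaustive, since \<open>x\<close> is a boundary path that cannot be continued beyond \<open>p\<close> in the
  directions of \<open>I\<close>.  A path \<open>\<mu>\<close> from \<open>x(p)\<close> without common extension with any of those edges has
  \<open>d(\<mu>)\<^sub>i = 0\<close> and \<open>s(\<mu>)\<close> emits no edge of degree \<open>e\<^sub>i\<close>, for all \<open>i \<in> I\<close>.  Following \<open>\<mu>\<close>, move on to a
  vertex whose set of blocked directions is maximal; from there one can travel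
  indefinitely in all other directions, and the resulting path, preceded by \<open>x(0, p)\<close> and \<open>\<mu>\<close>, is \<open>y\<close>.
\<close>

section \<open>Factors of finite paths and their segments\<close>

section \<open>Factorisation\<close>

context kgraph
begin

lemma factor_exists:
  assumes "l \<in> Mor \<Lambda>" and "m \<le> deg \<Lambda> l"
  obtains \<mu> \<nu> where "\<mu> \<in> Mor \<Lambda>" "\<nu> \<in> Mor \<Lambda>" "Src \<Lambda> \<mu> = Rng \<Lambda> \<nu>" "l = \<mu> \<cdot> \<nu>"
    "deg \<Lambda> \<mu> = m" "deg \<Lambda> \<nu> = deg \<Lambda> l - m"
proof -
  have "deg \<Lambda> l = m + (deg \<Lambda> l - m)"
    using assms(2) by (auto simp: fun_eq_iff le_fun_def)
  from ex1_implies_ex[OF factorisation[OF assms(1) this]] that show thesis by auto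
qed

text \<open>Equal degrees of the first factors force equal degrees of the second by cancellation, so
  the axiom \<open>factorisation\<close> covers both pairs.\<close>

lemma factor_unique:
  assumes "\<mu> \<in> Mor \<Lambda>" "\<nu> \<in> Mor \<Lambda>" "Src \<Lambda> \<mu> = Rng \<Lambda> \<nu>"
    and "\<mu>' \<in> Mor \<Lambda>" "\<nu>' \<in> Mor \<Lambda>" "Src \<Lambda> \<mu>' = Rng \<Lambda> \<nu>'"
    and eq: "\<mu> \<cdot> \<nu> = \<mu>' \<cdot> \<nu>'" and d: "deg \<Lambda> \<mu> = deg \<Lambda> \<mu>'"
  shows "\<mu> = \<mu>'" "\<nu> = \<nu>'"
proof -
  have "deg \<Lambda> \<mu> + deg \<Lambda> \<nu> = deg \<Lambda> \<mu>' + deg \<Lambda> \<nu>'"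
    using trans[OF deg_Cmp[OF assms(1-3), symmetric, unfolded eq] deg_Cmp[OF assms(4-6)]] .
  then have d': "deg \<Lambda> \<nu> = deg \<Lambda> \<nu>'"
    using d by (auto simp: fun_eq_iff)
  have "\<mu> \<cdot> \<nu> \<in> Mor \<Lambda>" "deg \<Lambda> (\<mu> \<cdot> \<nu>) = deg \<Lambda> \<mu> + deg \<Lambda> \<nu>"
    using Cmp_closed[OF assms(1-3)] deg_Cmp[OF assms(1-3)] by blast+
  from factorisation[OF this] obtain z where
    z: "\<And>a b. \<lbrakk>a \<in> Mor \<Lambda>; b \<in> Mor \<Lambda>; Src \<Lambda> a = Rng \<Lambda> b; \<mu> \<cdot> \<nu> = a \<cdot> b;
          deg \<Lambda> a = deg \<Lambda> \<mu>; deg \<Lambda> b = deg \<Lambda> \<nu>\<rbrakk> \<Longrightarrow> (a, b) = z"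
    by (elim ex1E) (metis (mono_tags, lifting) case_prodI)
  have "(\<mu>, \<nu>) = z" using assms by (intro z) auto
  moreover have "(\<mu>', \<nu>') = z" using assms d' by (intro z) auto
  ultimately show "\<mu> = \<mu>'" "\<nu> = \<nu>'" by auto
qed

lemma deg_0_Idn: "f \<in> Mor \<Lambda> \<Longrightarrow> deg \<Lambda> f = 0 \<Longrightarrow> f = Idn \<Lambda> (Rng \<Lambda> f)"
  using bij_betw_Idn Rng_Idn by (force simp: bij_betw_def)

text \<open>For \<open>p \<le> q\<close> this says that \<open>h\<close> is the segment from
  \<open>p\<close> to \<open>q\<close> of the finite path \<open>f\<close>.\<close>

definition middle_factor :: "'m \<Rightarrow> ('k \<Rightarrow> nat) \<Rightarrow> ('k \<Rightarrow> nat) \<Rightarrow> 'm \<Rightarrow> bool" where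
  "middle_factor f p q h \<longleftrightarrow> h \<in> Mor \<Lambda> \<and> deg \<Lambda> h = q - p \<and>
     (\<exists>\<mu>\<in>Mor \<Lambda>. \<exists>\<nu>\<in>Mor \<Lambda>. deg \<Lambda> \<mu> = p \<and> Src \<Lambda> \<mu> = Rng \<Lambda> h \<and> Src \<Lambda> h = Rng \<Lambda> \<nu> \<and>
        f = \<mu> \<cdot> (h \<cdot> \<nu>))"

lemma middle_factorI:
  assumes "h \<in> Mor \<Lambda>" "deg \<Lambda> h = q - p" "\<mu> \<in> Mor \<Lambda>" "\<nu> \<in> Mor \<Lambda>" "deg \<Lambda> \<mu> = p"
    "Src \<Lambda> \<mu> = Rng \<Lambda> h" "Src \<Lambda> h = Rng \<Lambda> \<nu>" "f = \<mu> \<cdot> (h \<cdot> \<nu>)"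
  shows "middle_factor f p q h"
  using assms unfolding middle_factor_def by blast

lemma middle_factor_exists:
  assumes "f \<in> Mor \<Lambda>" "p \<le> q" "q \<le> deg \<Lambda> f"
  obtains h where "middle_factor f p q h"
proof -
  obtain \<mu> k where k: "\<mu> \<in> Mor \<Lambda>" "k \<in> Mor \<Lambda>" "Src \<Lambda> \<mu> = Rng \<Lambda> k" "f = \<mu> \<cdot> k"
    "deg \<Lambda> \<mu> = p" "deg \<Lambda> k = deg \<Lambda> f - p"
    using factor_exists[OF assms(1) order_trans[OF assms(2,3)]] .
  have "q - p \<le> deg \<Lambda> k"
    using assms(3) k(6) by (auto simp: le_fun_def diff_le_mono)
  from factor_exists[OF k(2) this] obtain h \<nu> where
    h: "h \<in> Mor \<Lambda>" "\<nu> \<in> Mor \<Lambda>" "Src \<Lambda> h = Rng \<Lambda> \<nu>" "k = h \<cdot> \<nu>" "deg \<Lambda> h = q - p"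
    by metis
  have "middle_factor f p q h"
    by (rule middle_factorI[of h _ _ \<mu> \<nu>]) (use h k in \<open>auto simp: Rng_Cmp\<close>)
  then show thesis by (rule that)
qed

text \<open>Prolonging \<open>f\<close> at its source only enlarges the last factor
  \<open>\<nu>\<close>. This keeps the segments of a growing sequence of paths compatible.\<close>

lemma middle_factor_Cmp_right:
  assumes "middle_factor f p q h" "g \<in> Mor \<Lambda>" "Src \<Lambda> f = Rng \<Lambda> g"
  shows "middle_factor (f \<cdot> g) p q h"
proof -
  obtain \<mu> \<nu> where *: "\<mu> \<in> Mor \<Lambda>" "\<nu> \<in> Mor \<Lambda>" "h \<in> Mor \<Lambda>" "deg \<Lambda> h = q - p" "deg \<Lambda> \<mu> = p"
    "Src \<Lambda> \<mu> = Rng \<Lambda> h" "Src \<Lambda> h = Rng \<Lambda> \<nu>" "f = \<mu> \<cdot> (h \<cdot> \<nu>)"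
    using assms(1) unfolding middle_factor_def by auto
  have s: "Src \<Lambda> \<nu> = Rng \<Lambda> g"
    using assms(3) * by (simp add: Cmp_closed Rng_Cmp Src_Cmp)
  have "f \<cdot> g = \<mu> \<cdot> (h \<cdot> (\<nu> \<cdot> g))"
    using * s assms(2) by (simp add: Cmp_assoc Cmp_closed Rng_Cmp Src_Cmp)
  then show ?thesis
    by (rule middle_factorI[of h _ _ \<mu> "\<nu> \<cdot> g", rotated -1])
      (use * s assms(2) in \<open>auto simp: Cmp_closed Rng_Cmp\<close>)
qed

text \<open>Both \<open>\<mu> \<cdot> h\<close> and \<open>\<mu>'\<close> are initial factors of
  \<open>f\<close> of degree \<open>q\<close>, so unique factorisation identifies them, and also the
  remainders \<open>\<nu>\<close> and \<open>k \<cdot> \<nu>'\<close>.\<close>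

lemma middle_factor_Cmp:
  assumes "middle_factor f p q h" "middle_factor f q t k" "p \<le> q" "q \<le> t"
  shows "Src \<Lambda> h = Rng \<Lambda> k" "middle_factor f p t (h \<cdot> k)"
proof -
  obtain \<mu> \<nu> where h: "\<mu> \<in> Mor \<Lambda>" "\<nu> \<in> Mor \<Lambda>" "h \<in> Mor \<Lambda>" "deg \<Lambda> h = q - p" "deg \<Lambda> \<mu> = p"
    "Src \<Lambda> \<mu> = Rng \<Lambda> h" "Src \<Lambda> h = Rng \<Lambda> \<nu>" "f = \<mu> \<cdot> (h \<cdot> \<nu>)"
    using assms(1) unfolding middle_factor_def by auto
  obtain \<mu>' \<nu>' where k: "\<mu>' \<in> Mor \<Lambda>" "\<nu>' \<in> Mor \<Lambda>" "k \<in> Mor \<Lambda>" "deg \<Lambda> k = t - q" "deg \<Lambda> \<mu>' = q"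
    "Src \<Lambda> \<mu>' = Rng \<Lambda> k" "Src \<Lambda> k = Rng \<Lambda> \<nu>'" "f = \<mu>' \<cdot> (k \<cdot> \<nu>')"
    using assms(2) unfolding middle_factor_def by auto
  have "deg \<Lambda> (\<mu> \<cdot> h) = q"
    using h assms(3) by (auto simp: deg_Cmp fun_eq_iff le_fun_def)
  moreover have "(\<mu> \<cdot> h) \<cdot> \<nu> = \<mu>' \<cdot> (k \<cdot> \<nu>')"
    using h k by (simp add: Cmp_assoc)
  ultimately have eq: "\<mu> \<cdot> h = \<mu>'" "\<nu> = k \<cdot> \<nu>'"
    using h k factor_unique[of "\<mu> \<cdot> h" \<nu> \<mu>' "k \<cdot> \<nu>'"]
    by (auto simp: Cmp_closed Rng_Cmp Src_Cmp)
  then show s: "Src \<Lambda> h = Rng \<Lambda> k"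
    using h k by (simp add: Rng_Cmp)
  have "deg \<Lambda> (h \<cdot> k) = t - p"
    using h k s assms(3,4) by (auto simp: deg_Cmp fun_eq_iff le_fun_def)
  moreover have "f = \<mu> \<cdot> (h \<cdot> k \<cdot> \<nu>')"
    using h k s eq by (simp add: Cmp_assoc)
  ultimately show "middle_factor f p t (h \<cdot> k)"
    by (intro middle_factorI[of _ _ _ \<mu> \<nu>'])
      (use h k s in \<open>auto simp: Cmp_closed Rng_Cmp Src_Cmp\<close>)
qed

text \<open>Unique factorisation is used twice: to remove the initial factors of degree
  \<open>p\<close>, then to split the common remainder after \<open>h\<close> and \<open>k\<close>,
  whose degrees agree.\<close>

lemma middle_factor_unique:
  assumes "middle_factor f p q h" "middle_factor f p q k"
  shows "h = k"
proof -
  obtain \<mu> \<nu> where h: "\<mu> \<in> Mor \<Lambda>" "\<nu> \<in> Mor \<Lambda>" "h \<in> Mor \<Lambda>" "deg \<Lambda> h = q - p" "deg \<Lambda> \<mu> = p"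
    "Src \<Lambda> \<mu> = Rng \<Lambda> h" "Src \<Lambda> h = Rng \<Lambda> \<nu>" "f = \<mu> \<cdot> (h \<cdot> \<nu>)"
    using assms(1) unfolding middle_factor_def by auto
  obtain \<mu>' \<nu>' where k: "\<mu>' \<in> Mor \<Lambda>" "\<nu>' \<in> Mor \<Lambda>" "k \<in> Mor \<Lambda>" "deg \<Lambda> k = q - p" "deg \<Lambda> \<mu>' = p"
    "Src \<Lambda> \<mu>' = Rng \<Lambda> k" "Src \<Lambda> k = Rng \<Lambda> \<nu>'" "f = \<mu>' \<cdot> (k \<cdot> \<nu>')"
    using assms(2) unfolding middle_factor_def by auto
  have "h \<cdot> \<nu> = k \<cdot> \<nu>'"
    using h k factor_unique(2)[of \<mu> "h \<cdot> \<nu>" \<mu>' "k \<cdot> \<nu>'"] by (auto simp: Cmp_closed Rng_Cmp)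
  then show ?thesis
    using h k factor_unique(1)[of h \<nu> k \<nu>'] by auto
qed

lemma middle_factor_whole: "f \<in> Mor \<Lambda> \<Longrightarrow> middle_factor f 0 (deg \<Lambda> f) f"
  by (rule middle_factorI[of _ _ _ "Idn \<Lambda> (Rng \<Lambda> f)" "Idn \<Lambda> (Src \<Lambda> f)"])
    (auto simp: Idn_closed Rng_closed Src_closed deg_Idn Src_Idn Rng_Idn Idn_left Idn_right fun_eq_iff)


section \<open>Segments in the path space, and limits of growing sequences of finite paths\<close>

section \<open>Paths\<close>

lemma path_spaceD:
  assumes "x \<in> path_space \<Lambda>" "p \<le> q" "emb q \<le> pdeg x"
  shows "seg x (p, q) \<in> Mor \<Lambda>" "deg \<Lambda> (seg x (p, q)) = q - p"
    "Rng \<Lambda> (seg x (p, q)) = vert x p" "Src \<Lambda> (seg x (p, q)) = vert x q"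
proof -
  let ?\<Omega> = "Omega (pdeg x)"
  have F: "seg x \<in> Mor ?\<Omega> \<rightarrow>\<^sub>E Mor \<Lambda>" "\<forall>f\<in>Mor ?\<Omega>. deg \<Lambda> (seg x f) = deg ?\<Omega> f"
    "\<forall>f\<in>Mor ?\<Omega>. Rng \<Lambda> (seg x f) = vert x (Rng ?\<Omega> f) \<and> Src \<Lambda> (seg x f) = vert x (Src ?\<Omega> f)"
    using assms(1) unfolding path_space_def kgraph_morphism_def cat_functor_def by blast+
  have M: "(p, q) \<in> Mor ?\<Omega>" using assms(2,3) by (simp add: Omega_def)
  show "seg x (p, q) \<in> Mor \<Lambda>" using F(1) M by (rule PiE_mem)
  show "deg \<Lambda> (seg x (p, q)) = q - p" using bspec[OF F(2) M] by (simp add: Omega_def)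
  show "Rng \<Lambda> (seg x (p, q)) = vert x p" "Src \<Lambda> (seg x (p, q)) = vert x q"
    using bspec[OF F(3) M] by (simp_all add: Omega_def)
qed

lemma path_vert: "x \<in> path_space \<Lambda> \<Longrightarrow> emb p \<le> pdeg x \<Longrightarrow> vert x p \<in> Obj \<Lambda>"
  using path_spaceD(1,3)[of x p p] Rng_closed by (metis order_refl)

lemma emb_mono: "p \<le> q \<Longrightarrow> emb q \<le> D \<Longrightarrow> emb p \<le> D"
  by (auto simp: emb_def le_fun_def) (meson enat_ord_simps(1) order_trans)

lemma path_seg_Cmp:
  assumes "x \<in> path_space \<Lambda>" "p \<le> q" "q \<le> t" "emb t \<le> pdeg x"
  shows "seg x (p, t) = seg x (p, q) \<cdot> seg x (q, t)"
proof -
  let ?\<Omega> = "Omega (pdeg x)"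
  have "\<forall>f\<in>Mor ?\<Omega>. \<forall>g\<in>Mor ?\<Omega>. Src ?\<Omega> f = Rng ?\<Omega> g \<longrightarrow>
      seg x (f \<cdot>\<^bsub>?\<Omega>\<^esub> g) = seg x f \<cdot> seg x g"
    using assms(1) unfolding path_space_def kgraph_morphism_def cat_functor_def by blast
  moreover have "(p, q) \<in> Mor ?\<Omega>" "(q, t) \<in> Mor ?\<Omega>"
    using assms(2-4) emb_mono[OF assms(3,4)] by (auto simp: Omega_def)
  moreover have "Src ?\<Omega> (p, q) = Rng ?\<Omega> (q, t)" "(p, q) \<cdot>\<^bsub>?\<Omega>\<^esub> (q, t) = (p, t)"
    by (auto simp: Omega_def)
  ultimately show ?thesis by metis
qed

text \<open>Cutting \<open>seg x (n, q)\<close> at \<open>n + deg \<Lambda> l\<close> gives a second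
  factorisation with the same first degree, so it must be the given one.\<close>

lemma path_seg_eqI:
  assumes x: "x \<in> path_space \<Lambda>" "n \<le> q" "emb q \<le> pdeg x"
    and l: "l \<in> Mor \<Lambda>" "\<alpha> \<in> Mor \<Lambda>" "Src \<Lambda> l = Rng \<Lambda> \<alpha>"
    and eq: "seg x (n, q) = l \<cdot> \<alpha>"
  shows "n + deg \<Lambda> l \<le> q" "seg x (n, n + deg \<Lambda> l) = l"
    "seg x (n + deg \<Lambda> l, q) = \<alpha>"
proof -
  have d: "q - n = deg \<Lambda> l + deg \<Lambda> \<alpha>"
    using path_spaceD(2)[OF x] eq deg_Cmp[OF l] by simp
  show le: "n + deg \<Lambda> l \<le> q"
  proof (rule le_funI)
    fix i show "(n + deg \<Lambda> l) i \<le> q i"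
      using fun_cong[OF d, of i] le_funD[OF x(2), of i] by simp
  qed
  have nle: "n \<le> n + deg \<Lambda> l" by (auto simp: le_fun_def)
  have e: "emb (n + deg \<Lambda> l) \<le> pdeg x" using emb_mono[OF le x(3)] .
  have eq': "seg x (n, n + deg \<Lambda> l) \<cdot> seg x (n + deg \<Lambda> l, q) = l \<cdot> \<alpha>"
    using path_seg_Cmp[OF x(1) nle le x(3)] eq by metis
  note 1 = path_spaceD[OF x(1) nle e] and 2 = path_spaceD[OF x(1) le x(3)]
  have s: "Src \<Lambda> (seg x (n, n + deg \<Lambda> l)) = Rng \<Lambda> (seg x (n + deg \<Lambda> l, q))"
    using 1(4) 2(3) by metis
  have d': "deg \<Lambda> (seg x (n, n + deg \<Lambda> l)) = deg \<Lambda> l"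
    using 1(2) by (simp add: fun_eq_iff)
  show "seg x (n, n + deg \<Lambda> l) = l" "seg x (n + deg \<Lambda> l, q) = \<alpha>"
    using factor_unique[OF 1(1) 2(1) s l eq' d'] by blast+
qed

text \<open>The segment from \<open>p\<close> to \<open>q\<close> of the limit is read off from any
  \<open>g j\<close> long enough to contain it. By the assumption on \<open>D\<close>, the finite
  degrees below \<open>D\<close> are those reached by some \<open>g j\<close>, so each segment
  appears at a finite stage.\<close>

lemma limit_path:
  assumes g: "\<And>j. g j \<in> Mor \<Lambda>"
    and step: "\<And>j. \<exists>h\<in>Mor \<Lambda>. Src \<Lambda> (g j) = Rng \<Lambda> h \<and> g (Suc j) = g j \<cdot> h"
    and D: "\<And>q. emb q \<le> D \<longleftrightarrow> (\<exists>j. q \<le> deg \<Lambda> (g j))"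
  obtains y where "y \<in> path_space \<Lambda>" "pdeg y = D" "\<And>j. seg y (0, deg \<Lambda> (g j)) = g j"
proof -
  \<comment> \<open>The description is well defined: \<open>mono\<close> moves two stages to a
    common later one, where segments are unique; \<open>s_eq\<close> records this.\<close>
  define s where "s p q = (THE h. \<exists>j. middle_factor (g j) p q h)" for p q
  have mono: "middle_factor (g j') p q h" if "middle_factor (g j) p q h" "j \<le> j'" for j j' p q h
    using that(2,1)
  proof (induction rule: dec_induct)
    case (step j')
    obtain h' where h': "h' \<in> Mor \<Lambda>" "Src \<Lambda> (g j') = Rng \<Lambda> h'" "g (Suc j') = g j' \<cdot> h'"
      using assms(2)[of j'] by blast
    show ?case
      unfolding h'(3) by (rule middle_factor_Cmp_right[OF step.IH[OF step.prems] h'(1,2)])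
  qed
  have s_eq: "s p q = h" if h: "middle_factor (g j) p q h" for j p q h
    unfolding s_def
  proof (rule the_equality)
    fix k assume "\<exists>j. middle_factor (g j) p q k"
    then obtain j' where "middle_factor (g j') p q k" ..
    from mono[OF this max.cobounded2] mono[OF h max.cobounded1]
    show "k = h" by (rule middle_factor_unique)
  qed (rule exI, rule h)
  \<comment> \<open>A single stage \<open>j\<close> serves all segments ending by \<open>q\<close>,
    so composites can be compared inside one finite path.\<close>
  have s: "\<exists>j. \<forall>p t. p \<le> t \<longrightarrow> t \<le> q \<longrightarrow> middle_factor (g j) p t (s p t)" if le: "emb q \<le> D" for q
  proof -
    obtain j where j: "q \<le> deg \<Lambda> (g j)" using D[THEN iffD1, OF le] ..
    have "middle_factor (g j) p t (s p t)" if pt: "p \<le> t" "t \<le> q" for p t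
    proof -
      obtain h where h: "middle_factor (g j) p t h"
        using middle_factor_exists[OF g pt(1) order_trans[OF pt(2) j]] .
      then show ?thesis unfolding s_eq[OF h] .
    qed
    then show ?thesis by (intro exI allI impI)
  qed
  have s_Mor: "s p q \<in> Mor \<Lambda>" "deg \<Lambda> (s p q) = q - p" if le: "p \<le> q" "emb q \<le> D" for p q
  proof -
    obtain j where "middle_factor (g j) p q (s p q)" using s[OF le(2)] le(1) by blast
    then show "s p q \<in> Mor \<Lambda>" "deg \<Lambda> (s p q) = q - p" unfolding middle_factor_def by blast+
  qed
  have s_Cmp: "Src \<Lambda> (s p q) = Rng \<Lambda> (s q t)" "s p t = s p q \<cdot> s q t"
    if le: "p \<le> q" "q \<le> t" "emb t \<le> D" for p q t
  proof -
    obtain j where j: "\<And>p q. p \<le> q \<Longrightarrow> q \<le> t \<Longrightarrow> middle_factor (g j) p q (s p q)"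
      using s[OF le(3)] by blast
    show "Src \<Lambda> (s p q) = Rng \<Lambda> (s q t)"
      by (rule middle_factor_Cmp(1)[OF j[OF le(1,2)] j[OF le(2) order_refl] le(1,2)])
    have "middle_factor (g j) p t (s p q \<cdot> s q t)"
      by (rule middle_factor_Cmp(2)[OF j[OF le(1,2)] j[OF le(2) order_refl] le(1,2)])
    then show "s p t = s p q \<cdot> s q t" by (rule s_eq)
  qed
  have s_Idn: "s p p = Idn \<Lambda> (Rng \<Lambda> (s p p))" if "emb p \<le> D" for p
    using s_Mor[OF order_refl that] by (intro deg_0_Idn) (simp_all add: fun_eq_iff)
  have s_Rng: "Rng \<Lambda> (s p q) = Rng \<Lambda> (s p p)" "Src \<Lambda> (s p q) = Rng \<Lambda> (s q q)"
    if "p \<le> q" "emb q \<le> D" for p q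
  proof -
    have e: "emb p \<le> D" using emb_mono that by blast
    have "Src \<Lambda> (s p p) = Rng \<Lambda> (s p q)" using s_Cmp(1)[of p p q] that by simp
    moreover have "Src \<Lambda> (s p p) = Rng \<Lambda> (s p p)"
      using s_Idn[OF e] Src_Idn Rng_closed s_Mor(1)[of p p] e by (metis order_refl)
    ultimately show "Rng \<Lambda> (s p q) = Rng \<Lambda> (s p p)" by simp
    show "Src \<Lambda> (s p q) = Rng \<Lambda> (s q q)" using s_Cmp(1)[of p q q] that by simp
  qed
  \<comment> \<open>The vertex at \<open>p\<close> is the range of the degree-0 segment
    \<open>s p p\<close>; \<open>restrict\<close> supplies the extensionality demanded by
    \<open>cat_functor\<close>.\<close>
  define y :: "('o, 'm, 'k) path" where
    "y = \<lparr>pdeg = D, vert = restrict (\<lambda>p. Rng \<Lambda> (s p p)) {p. emb p \<le> D},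
          seg = restrict (\<lambda>(p, q). s p q) {(p, q). p \<le> q \<and> emb q \<le> D}\<rparr>"
  have vert_y: "vert y p = Rng \<Lambda> (s p p)" if "emb p \<le> D" for p
    using that by (simp add: y_def)
  have seg_y: "seg y (p, q) = s p q" if "p \<le> q" "emb q \<le> D" for p q
    using that by (simp add: y_def)
  let ?\<Omega> = "Omega D"
  have M: "Mor ?\<Omega> = {(p, q). p \<le> q \<and> emb q \<le> D}" "Obj ?\<Omega> = {p. emb p \<le> D}"
    by (simp_all add: Omega_def)
  have "kgraph_morphism ?\<Omega> \<Lambda> (vert y) (seg y)"
    unfolding kgraph_morphism_def cat_functor_def M
  proof (intro conjI ballI impI)
    show "vert y \<in> {p. emb p \<le> D} \<rightarrow>\<^sub>E Obj \<Lambda>"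
      using s_Mor(1)[OF order_refl] by (auto simp: y_def intro: Rng_closed)
    show "seg y \<in> {(p, q). p \<le> q \<and> emb q \<le> D} \<rightarrow>\<^sub>E Mor \<Lambda>"
      using s_Mor(1) by (auto simp: y_def)
  next
    fix p assume "p \<in> {p. emb p \<le> D}"
    then have p: "emb p \<le> D" by simp
    show "seg y (Idn ?\<Omega> p) = Idn \<Lambda> (vert y p)"
      using s_Idn[OF p] by (simp add: vert_y[OF p] seg_y[OF order_refl p] Omega_def)
  next
    fix f assume "f \<in> {(p, q). p \<le> q \<and> emb q \<le> D}"
    then obtain p q where f: "f = (p, q)" and pq: "p \<le> q" "emb q \<le> D" by blast
    have p: "emb p \<le> D" using emb_mono[OF pq] .
    show "Rng \<Lambda> (seg y f) = vert y (Rng ?\<Omega> f)" "Src \<Lambda> (seg y f) = vert y (Src ?\<Omega> f)"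
      "deg \<Lambda> (seg y f) = deg ?\<Omega> f"
      by (simp_all only: f seg_y[OF pq] s_Rng[OF pq] s_Mor(2)[OF pq])
        (simp_all add: Omega_def vert_y p pq)
    fix f' assume "f' \<in> {(p, q). p \<le> q \<and> emb q \<le> D}" "Src ?\<Omega> f = Rng ?\<Omega> f'"
    then obtain t where f': "f' = (q, t)" and qt: "q \<le> t" "emb t \<le> D"
      by (auto simp: Omega_def f)
    have "seg y (p, t) = seg y (p, q) \<cdot> seg y (q, t)"
      using s_Cmp(2)[OF pq(1) qt] seg_y[OF pq] seg_y[OF qt] seg_y[OF order_trans[OF pq(1) qt(1)] qt(2)]
      by simp
    then show "seg y (f \<cdot>\<^bsub>?\<Omega>\<^esub> f') = seg y f \<cdot> seg y f'"
      by (simp add: f f' Omega_def)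
  qed
  then have "y \<in> path_space \<Lambda>" by (simp add: path_space_def y_def)
  moreover have "seg y (0, deg \<Lambda> (g j)) = g j" for j
  proof -
    have "emb (deg \<Lambda> (g j)) \<le> D" using D by blast
    moreover have "s 0 (deg \<Lambda> (g j)) = g j"
      using s_eq middle_factor_whole g by blast
    ultimately show ?thesis by (simp add: y_def le_fun_def)
  qed
  ultimately show thesis using that[of y] by (simp add: y_def)
qed


section \<open>Directions without edges, and prolonging a finite path to one in
  \<open>le_infty_paths\<close>\<close>

section \<open>Blocked directions\<close>

definition blocked :: "'o \<Rightarrow> 'k set" where
  "blocked v = {i. paths_from \<Lambda> v (unit_deg i) = {}}"

lemma unit_deg_le: "unit_deg i \<le> m \<longleftrightarrow> 0 < m i"
  by (auto simp: unit_deg_def le_fun_def)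

text \<open>A positive \<open>i\<close>-th degree would let an edge of degree
  \<open>unit_deg i\<close> be split off at the range of \<open>f\<close>.\<close>

lemma blocked_deg:
  assumes "f \<in> Mor \<Lambda>" "i \<in> blocked (Rng \<Lambda> f)"
  shows "deg \<Lambda> f i = 0"
proof (rule ccontr)
  assume "deg \<Lambda> f i \<noteq> 0"
  then have "unit_deg i \<le> deg \<Lambda> f" by (simp add: unit_deg_le)
  from factor_exists[OF assms(1) this] obtain \<mu> \<nu> where
    "\<mu> \<in> Mor \<Lambda>" "\<nu> \<in> Mor \<Lambda>" "Src \<Lambda> \<mu> = Rng \<Lambda> \<nu>" "f = \<mu> \<cdot> \<nu>" "deg \<Lambda> \<mu> = unit_deg i" by metis
  then have "\<mu> \<in> paths_from \<Lambda> (Rng \<Lambda> f) (unit_deg i)" by (simp add: paths_from_def Rng_Cmp)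
  then show False using assms(2) by (auto simp: blocked_def)
qed

text \<open>An edge \<open>e\<close> in direction \<open>i\<close> at the source would make the
  \<open>i\<close>-th degree of \<open>f \<cdot> e\<close> positive, against
  \<open>blocked_deg\<close>.\<close>

lemma blocked_mono:
  assumes "f \<in> Mor \<Lambda>"
  shows "blocked (Rng \<Lambda> f) \<subseteq> blocked (Src \<Lambda> f)"
proof
  fix i assume i: "i \<in> blocked (Rng \<Lambda> f)"
  show "i \<in> blocked (Src \<Lambda> f)"
    unfolding blocked_def
  proof (clarify, rule equals0I)
    fix e assume e: "e \<in> paths_from \<Lambda> (Src \<Lambda> f) (unit_deg i)"
    then have "deg \<Lambda> (f \<cdot> e) i = 0"
      using assms i by (intro blocked_deg) (auto simp: paths_from_def Cmp_closed Rng_Cmp)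
    then show False using e assms by (auto simp: paths_from_def deg_Cmp unit_deg_def)
  qed
qed

text \<open>Blocked sets grow along paths but stay inside a finite type, so a path from
  \<open>v\<close> whose source has the largest possible blocked set leaves no room for
  growth.\<close>

lemma blocked_stabilises:
  assumes "v \<in> Obj \<Lambda>"
  obtains f where "f \<in> Mor \<Lambda>" "Rng \<Lambda> f = v"
    "\<And>h. h \<in> Mor \<Lambda> \<Longrightarrow> Rng \<Lambda> h = Src \<Lambda> f \<Longrightarrow> blocked (Src \<Lambda> h) = blocked (Src \<Lambda> f)"
proof -
  let ?P = "\<lambda>f. f \<in> Mor \<Lambda> \<and> Rng \<Lambda> f = v"
  let ?c = "\<lambda>f. card (blocked (Src \<Lambda> f))"
  have "?P (Idn \<Lambda> v)" using assms by (simp add: Idn_closed Rng_Idn)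
  \<comment> \<open>\<open>ex_has_greatest_nat\<close> asks for a strict bound, hence the
    successor.\<close>
  moreover have "\<forall>f. ?P f \<longrightarrow> ?c f < Suc (card (UNIV :: 'k set))"
    by (simp add: less_Suc_eq_le card_mono)
  ultimately obtain f where f: "?P f" "\<And>f'. ?P f' \<Longrightarrow> ?c f' \<le> ?c f"
    using ex_has_greatest_nat[of ?P "Idn \<Lambda> v" ?c "Suc (card (UNIV :: 'k set))"] by auto
  show thesis
  proof (rule that)
    fix h assume h: "h \<in> Mor \<Lambda>" "Rng \<Lambda> h = Src \<Lambda> f"
    have "?c (f \<cdot> h) \<le> ?c f" using f h by (intro f(2)) (simp add: Cmp_closed Rng_Cmp)
    then have "card (blocked (Src \<Lambda> h)) \<le> card (blocked (Src \<Lambda> f))"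
      using f h by (simp add: Src_Cmp)
    moreover have "blocked (Src \<Lambda> f) \<subseteq> blocked (Src \<Lambda> h)" using blocked_mono[OF h(1)] h(2) by simp
    ultimately show "blocked (Src \<Lambda> h) = blocked (Src \<Lambda> f)"
      by (metis card_seteq finite)
  qed (use f in auto)
qed

text \<open>Edges are appended one direction at a time. By \<open>stable\<close> the blocked set is
  still \<open>T\<close> at each vertex reached, so every direction of \<open>A\<close> remains
  available.\<close>

lemma exists_path_unblocked:
  assumes stable: "\<And>h. h \<in> Mor \<Lambda> \<Longrightarrow> Rng \<Lambda> h = w \<Longrightarrow> blocked (Src \<Lambda> h) = T"
    and w: "w \<in> Obj \<Lambda>" and A: "A \<inter> T = {}"
  shows "\<exists>f\<in>Mor \<Lambda>. Rng \<Lambda> f = w \<and> deg \<Lambda> f = (\<lambda>i. if i \<in> A then 1 else 0)"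
  using finite[of A] A
proof (induction A rule: finite_induct)
  case empty
  show ?case using w by (intro bexI[of _ "Idn \<Lambda> w"]) (auto simp: Idn_closed Rng_Idn deg_Idn)
next
  case (insert a A)
  then obtain f where f: "f \<in> Mor \<Lambda>" "Rng \<Lambda> f = w" "deg \<Lambda> f = (\<lambda>i. if i \<in> A then 1 else 0)"
    by auto
  then have "a \<notin> blocked (Src \<Lambda> f)" using stable insert.prems by auto
  then obtain e where "e \<in> paths_from \<Lambda> (Src \<Lambda> f) (unit_deg a)" by (auto simp: blocked_def)
  then show ?case using f insert.hyps
    by (intro bexI[of _ "f \<cdot> e"])
      (auto simp: paths_from_def Rng_Cmp deg_Cmp Cmp_closed unit_deg_def fun_eq_iff)
qed

lemma extend_to_le_infty:
  assumes f: "f \<in> Mor \<Lambda>"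
  obtains y where "y \<in> le_infty_paths \<Lambda>" "emb (deg \<Lambda> f) \<le> pdeg y" "seg y (0, deg \<Lambda> f) = f"
    "\<And>i. i \<in> blocked (Src \<Lambda> f) \<Longrightarrow> pdeg y i = enat (deg \<Lambda> f i)"
proof -
  obtain f' where f': "f' \<in> Mor \<Lambda>" "Rng \<Lambda> f' = Src \<Lambda> f"
    "\<And>h. h \<in> Mor \<Lambda> \<Longrightarrow> Rng \<Lambda> h = Src \<Lambda> f' \<Longrightarrow> blocked (Src \<Lambda> h) = blocked (Src \<Lambda> f')"
    using blocked_stabilises[OF Src_closed[OF f]] by metis
  define w where "w = Src \<Lambda> f'"
  define T where "T = blocked w"
  \<comment> \<open>The degree of one round: a single step in each direction outside
    \<open>T\<close>.\<close>
  define c :: "'k \<Rightarrow> nat" where "c = (\<lambda>i. if i \<in> - T then 1 else 0)"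
  have stable: "blocked (Src \<Lambda> h) = T" if "h \<in> Mor \<Lambda>" "Rng \<Lambda> h = w" for h
    using f'(3) that by (simp add: T_def w_def)
  have next_ex: "\<exists>k\<in>Mor \<Lambda>. Rng \<Lambda> k = Src \<Lambda> h \<and> deg \<Lambda> k = c" if h: "h \<in> Mor \<Lambda>" "Rng \<Lambda> h = w" for h
    unfolding c_def
  proof (rule exists_path_unblocked)
    fix k assume "k \<in> Mor \<Lambda>" "Rng \<Lambda> k = Src \<Lambda> h"
    then show "blocked (Src \<Lambda> k) = T"
      using stable[of "h \<cdot> k"] h by (simp add: Cmp_closed Rng_Cmp Src_Cmp)
  next
    show "Src \<Lambda> h \<in> Obj \<Lambda>" using h(1) by (rule Src_closed)
  qed simp
  define nxt where "nxt h = h \<cdot> (SOME k. k \<in> Mor \<Lambda> \<and> Rng \<Lambda> k = Src \<Lambda> h \<and> deg \<Lambda> k = c)" for h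
  have nxt: "\<exists>k\<in>Mor \<Lambda>. Src \<Lambda> h = Rng \<Lambda> k \<and> nxt h = h \<cdot> k \<and> deg \<Lambda> k = c"
    if h: "h \<in> Mor \<Lambda>" "Rng \<Lambda> h = w" for h
  proof -
    let ?P = "\<lambda>k. k \<in> Mor \<Lambda> \<and> Rng \<Lambda> k = Src \<Lambda> h \<and> deg \<Lambda> k = c"
    have "\<exists>k. ?P k" using next_ex[OF h] by blast
    then have "?P (SOME k. ?P k)" by (rule someI_ex)
    then show ?thesis unfolding nxt_def by (intro bexI[of _ "SOME k. ?P k"]) simp_all
  qed
  define h where "h j = (nxt ^^ j) (Idn \<Lambda> w)" for j
  have w: "w \<in> Obj \<Lambda>" using f' by (simp add: w_def Src_closed)
  have h: "h j \<in> Mor \<Lambda> \<and> Rng \<Lambda> (h j) = w \<and> deg \<Lambda> (h j) = (\<lambda>i. j * c i)" for j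
  proof (induction j)
    case 0
    then show ?case using w by (simp add: h_def Idn_closed Rng_Idn deg_Idn fun_eq_iff)
  next
    case (Suc j)
    then obtain k where "k \<in> Mor \<Lambda>" "Src \<Lambda> (h j) = Rng \<Lambda> k" "nxt (h j) = h j \<cdot> k" "deg \<Lambda> k = c"
      using nxt by blast
    moreover have "h (Suc j) = nxt (h j)" by (simp add: h_def)
    ultimately show ?case using Suc by (simp add: Cmp_closed Rng_Cmp deg_Cmp fun_eq_iff)
  qed
  define a where "a = deg \<Lambda> (f \<cdot> f')"
  have ff': "f \<cdot> f' \<in> Mor \<Lambda>" "Src \<Lambda> (f \<cdot> f') = w"
    using f f' by (auto simp: Cmp_closed Src_Cmp w_def)
  define g where "g j = (f \<cdot> f') \<cdot> h j" for j
  define D where "D = (\<lambda>i. if i \<in> T then enat (a i) else \<infinity>)"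
  have g: "g j \<in> Mor \<Lambda>" "deg \<Lambda> (g j) = (\<lambda>i. a i + j * c i)" for j
    using h[of j] ff' by (auto simp: g_def Cmp_closed deg_Cmp a_def fun_eq_iff)
  have step: "\<exists>k\<in>Mor \<Lambda>. Src \<Lambda> (g j) = Rng \<Lambda> k \<and> g (Suc j) = g j \<cdot> k" for j
  proof -
    obtain k where "k \<in> Mor \<Lambda>" "Src \<Lambda> (h j) = Rng \<Lambda> k" "nxt (h j) = h j \<cdot> k"
      using nxt h by blast
    then show ?thesis
      using h[of j] ff' by (intro bexI[of _ k]) (auto simp: g_def h_def Src_Cmp Cmp_assoc)
  qed
  have D: "emb q \<le> D \<longleftrightarrow> (\<exists>j. q \<le> deg \<Lambda> (g j))" for q
  proof
    assume le: "emb q \<le> D"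
    \<comment> \<open>Each round adds 1 to every coordinate outside \<open>T\<close>, so
      \<open>sum q UNIV\<close> rounds suffice for all coordinates at once.\<close>
    have "q i \<le> a i + sum q UNIV * c i" for i
    proof (cases "i \<in> T")
      case True
      then show ?thesis using le_funD[OF le, of i] by (simp add: emb_def D_def)
    next
      case False
      have "q i \<le> sum q UNIV" by (rule member_le_sum) auto
      then show ?thesis using False by (simp add: c_def)
    qed
    then show "\<exists>j. q \<le> deg \<Lambda> (g j)" using g(2) by (auto simp: le_fun_def)
  next
    assume "\<exists>j. q \<le> deg \<Lambda> (g j)"
    then obtain j where "q i \<le> a i + j * c i" for i using g(2) by (auto simp: le_fun_def)
    then show "emb q \<le> D"
      by (fastforce simp: emb_def D_def c_def le_fun_def split: if_splits)
  qed
  obtain y where y: "y \<in> path_space \<Lambda>" "pdeg y = D" "\<And>j. seg y (0, deg \<Lambda> (g j)) = g j"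
    by (rule limit_path[OF g(1) step D]) (rule that)
  have g0: "g 0 = f \<cdot> f'" "deg \<Lambda> (g 0) = a"
    using Idn_right[OF ff'(1)] ff'(2) by (simp_all add: g_def h_def a_def)
  have seg_a: "seg y (0, a) = f \<cdot> f'" using y(3)[of 0] g0 by simp
  have a: "emb a \<le> pdeg y" unfolding y(2) D using g0(2) by (metis order_refl)
  have zero_le: "0 \<le> q" for q :: "'k \<Rightarrow> nat" by (simp add: le_fun_def)
  have va: "vert y a = w" using path_spaceD(4)[OF y(1) zero_le a] seg_a ff' by simp
  \<comment> \<open>The threshold is \<open>a\<close>: every vertex of \<open>y\<close> beyond it is
    reached from \<open>w\<close>, hence has blocked set \<open>T\<close>, and only the coordinates
    in \<open>T\<close> have finite degree.\<close>
  have "y \<in> le_infty_paths \<Lambda>"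
    unfolding le_infty_paths_def
  proof (intro CollectI conjI exI[of _ a] allI impI)
    show "y \<in> path_space \<Lambda>" "emb a \<le> pdeg y" by (fact y(1) a)+
  next
    fix n i assume n: "a \<le> n \<and> emb n \<le> pdeg y \<and> enat (n i) = pdeg y i"
    then have "i \<in> T" by (auto simp: y(2) D_def split: if_splits)
    moreover have "blocked (vert y n) = T"
    proof -
      note path_spaceD[OF y(1) conjunct1[OF n] conjunct1[OF conjunct2[OF n]]]
      then show ?thesis using stable[of "seg y (a, n)"] va by simp
    qed
    ultimately show "paths_from \<Lambda> (vert y n) (unit_deg i) = {}" by (auto simp: blocked_def)
  qed
  moreover have "f \<in> Mor \<Lambda>" "f' \<in> Mor \<Lambda>" "Src \<Lambda> f = Rng \<Lambda> f'" using f f' by auto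
  note sf = path_seg_eqI[OF y(1) zero_le a this seg_a]
  have "seg y (0, deg \<Lambda> f) = f" "emb (deg \<Lambda> f) \<le> pdeg y"
    using sf emb_mono[OF _ a] by auto
  moreover have "pdeg y i = enat (deg \<Lambda> f i)" if i: "i \<in> blocked (Src \<Lambda> f)" for i
  proof -
    have "i \<in> T" using i blocked_mono[OF f'(1)] f'(2) by (auto simp: T_def w_def)
    \<comment> \<open>The range of \<open>f'\<close> is the source of \<open>f\<close>, where
      \<open>i\<close> is blocked; hence \<open>a i\<close> is
      \<open>deg \<Lambda> f i\<close>.\<close>
    moreover have "deg \<Lambda> f' i = 0" using blocked_deg f' i by simp
    ultimately show ?thesis using f f' by (simp add: y(2) D_def a_def deg_Cmp)
  qed
  ultimately show thesis using that by blast
qed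


section \<open>Exhaustive sets, and the comparison of \<open>x\<close> with \<open>y\<close>\<close>

section \<open>Boundary paths\<close>

text \<open>Follow \<open>y\<close> from \<open>n\<close> so far that a minimal common extension
  with a member of \<open>E\<close> adds nothing; that member is then an initial segment.\<close>

lemma le_infty_boundary:
  assumes "y \<in> le_infty_paths \<Lambda>"
  shows "y \<in> boundary_paths \<Lambda>"
proof -
  obtain n0 where y: "y \<in> path_space \<Lambda>" and n0: "emb n0 \<le> pdeg y"
    and bl: "\<And>n i. \<lbrakk>n0 \<le> n; emb n \<le> pdeg y; enat (n i) = pdeg y i\<rbrakk> \<Longrightarrow> i \<in> blocked (vert y n)"
    using assms by (auto simp: le_infty_paths_def blocked_def)
  have "\<exists>m. n \<le> m \<and> emb m \<le> pdeg y \<and> seg y (n, m) \<in> E"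
    if n: "emb n \<le> pdeg y" and E: "E \<in> FE \<Lambda> (vert y n)" for n E
  proof -
    \<comment> \<open>In an infinite coordinate the sum dominates the degree of every member of
      \<open>E\<close>, and the maximum passes the threshold \<open>n0\<close>; in a finite one
      \<open>q\<close> exhausts the degree of \<open>y\<close>.\<close>
    define q where "q = (\<lambda>i. if pdeg y i = \<infinity> then max (n0 i) (n i + (\<Sum>l\<in>E. deg \<Lambda> l i))
                             else the_enat (pdeg y i))"
    have finE: "finite E" using E by (simp add: FE_def)
    have le: "n \<le> q" "n0 \<le> q"
    proof -
      have "n i \<le> q i \<and> n0 i \<le> q i" for i
        using le_funD[OF n, of i] le_funD[OF n0, of i]
        by (cases "pdeg y i") (auto simp: q_def emb_def)
      then show "n \<le> q" "n0 \<le> q" by (auto simp: le_fun_def)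
    qed
    have "emb q i \<le> pdeg y i" for i by (cases "pdeg y i") (auto simp: emb_def q_def)
    then have q: "emb q \<le> pdeg y" by (simp add: le_fun_def)
    define \<mu> where "\<mu> = seg y (n, q)"
    have \<mu>: "\<mu> \<in> Mor \<Lambda>" "Rng \<Lambda> \<mu> = vert y n" "Src \<Lambda> \<mu> = vert y q" "deg \<Lambda> \<mu> = q - n"
      using path_spaceD[OF y le(1) q] by (auto simp: \<mu>_def)
    obtain l where l: "l \<in> E" "MCE \<Lambda> l \<mu> \<noteq> {}" "l \<in> Mor \<Lambda>"
      using E \<mu> unfolding FE_def exhaustive_def by blast
    obtain \<alpha> \<beta> where \<alpha>: "\<alpha> \<in> Mor \<Lambda>" "Src \<Lambda> l = Rng \<Lambda> \<alpha>" and \<beta>: "\<beta> \<in> Mor \<Lambda>" "Src \<Lambda> \<mu> = Rng \<Lambda> \<beta>"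
      and eq: "l \<cdot> \<alpha> = \<mu> \<cdot> \<beta>" and d: "deg \<Lambda> (\<mu> \<cdot> \<beta>) = sup (deg \<Lambda> l) (deg \<Lambda> \<mu>)"
      using l(2) unfolding MCE_def by auto
    \<comment> \<open>\<open>\<beta>\<close> is what the common extension adds to
      \<open>\<mu>\<close>: nothing in infinite coordinates, where \<open>\<mu>\<close> already
      dominates \<open>l\<close>, and nothing in finite ones, which are blocked at the source of
      \<open>\<mu>\<close>.\<close>
    have "deg \<Lambda> \<beta> i = 0" for i
    proof (cases "pdeg y i = \<infinity>")
      case True
      have "deg \<Lambda> l i \<le> (\<Sum>l\<in>E. deg \<Lambda> l i)" using finE l(1) by (intro member_le_sum) auto
      then have "deg \<Lambda> l i \<le> deg \<Lambda> \<mu> i" using True by (simp add: \<mu>(4) q_def)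
      then show ?thesis using fun_cong[OF d, of i] \<mu>(1) \<beta> by (simp add: deg_Cmp sup_max)
    next
      case False
      then have "enat (q i) = pdeg y i" by (auto simp: q_def)
      then have "i \<in> blocked (Rng \<Lambda> \<beta>)" using bl[OF le(2) q] \<mu>(3) \<beta>(2) by simp
      then show ?thesis using blocked_deg \<beta>(1) by blast
    qed
    then have "\<beta> = Idn \<Lambda> (Src \<Lambda> \<mu>)" using deg_0_Idn[OF \<beta>(1)] \<beta>(2) by (simp add: fun_eq_iff)
    then have "seg y (n, q) = l \<cdot> \<alpha>" using eq Idn_right[OF \<mu>(1)] \<mu>_def by simp
    note s = path_seg_eqI[OF y le(1) q l(3) \<alpha> this]
    show ?thesis
      using s emb_mono[OF s(1) q] l(1)
      by (intro exI[of _ "n + deg \<Lambda> l"]) (auto simp: le_fun_def)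
  qed
  then show ?thesis using y by (auto simp: boundary_paths_def)
qed

text \<open>Some \<open>\<mu>\<close> has no minimal common extension with any of the edges. If a
  conclusion failed, one would exist: \<open>\<mu>\<close> itself, or \<open>\<mu>\<close> followed
  by an edge.\<close>

lemma nonexhaustive_edges:
  assumes v: "v \<in> Obj \<Lambda>"
    and ne: "\<not> exhaustive \<Lambda> v (\<Union>i\<in>I. paths_from \<Lambda> v (unit_deg i))"
  obtains \<mu> where "\<mu> \<in> Mor \<Lambda>" "Rng \<Lambda> \<mu> = v" "\<And>i. i \<in> I \<Longrightarrow> deg \<Lambda> \<mu> i = 0"
    "I \<subseteq> blocked (Src \<Lambda> \<mu>)"
proof -
  obtain \<mu> where \<mu>: "\<mu> \<in> Mor \<Lambda>" "Rng \<Lambda> \<mu> = v"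
    and no: "\<And>i l. i \<in> I \<Longrightarrow> l \<in> paths_from \<Lambda> v (unit_deg i) \<Longrightarrow> MCE \<Lambda> l \<mu> = {}"
    using ne unfolding exhaustive_def paths_from_def by blast
  \<comment> \<open>An extension of this degree begins with an edge \<open>l\<close> of degree
    \<open>unit_deg i\<close>, so it would lie in the empty set
    \<open>MCE \<Lambda> l \<mu>\<close>.\<close>
  have no_ext: False if i: "i \<in> I" and \<beta>: "\<beta> \<in> Mor \<Lambda>" "Src \<Lambda> \<mu> = Rng \<Lambda> \<beta>"
    and d: "deg \<Lambda> (\<mu> \<cdot> \<beta>) = sup (unit_deg i) (deg \<Lambda> \<mu>)" for i \<beta>
  proof -
    have "\<mu> \<cdot> \<beta> \<in> Mor \<Lambda>" "unit_deg i \<le> deg \<Lambda> (\<mu> \<cdot> \<beta>)" using \<mu> \<beta> d by (auto simp: Cmp_closed)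
    from factor_exists[OF this] obtain l \<alpha> where l: "l \<in> Mor \<Lambda>" "\<alpha> \<in> Mor \<Lambda>" "Src \<Lambda> l = Rng \<Lambda> \<alpha>"
      "\<mu> \<cdot> \<beta> = l \<cdot> \<alpha>" "deg \<Lambda> l = unit_deg i" by metis
    have "Rng \<Lambda> l = v" using l \<mu> \<beta> Rng_Cmp by metis
    then have "l \<in> paths_from \<Lambda> v (unit_deg i)" using l by (simp add: paths_from_def)
    moreover have "\<mu> \<cdot> \<beta> \<in> MCE \<Lambda> l \<mu>"
      unfolding MCE_def using l \<mu> \<beta> d by (auto simp: Cmp_closed)
    ultimately show False using no[OF i] by blast
  qed
  have d0: "deg \<Lambda> \<mu> i = 0" if i: "i \<in> I" for i
  proof (rule ccontr)
    assume "deg \<Lambda> \<mu> i \<noteq> 0"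
    then have "unit_deg i \<le> deg \<Lambda> \<mu>" by (simp add: unit_deg_le)
    then have "deg \<Lambda> (\<mu> \<cdot> Idn \<Lambda> (Src \<Lambda> \<mu>)) = sup (unit_deg i) (deg \<Lambda> \<mu>)"
      using \<mu> by (simp add: Idn_right sup_absorb2)
    then show False
      using no_ext[OF i, of "Idn \<Lambda> (Src \<Lambda> \<mu>)"] \<mu> by (simp add: Idn_closed Rng_Idn Src_closed)
  qed
  moreover have "I \<subseteq> blocked (Src \<Lambda> \<mu>)"
  proof
    fix i assume i: "i \<in> I"
    show "i \<in> blocked (Src \<Lambda> \<mu>)"
      unfolding blocked_def
    proof (clarify, rule equals0I)
      fix e assume e: "e \<in> paths_from \<Lambda> (Src \<Lambda> \<mu>) (unit_deg i)"
      \<comment> \<open>As \<open>\<mu>\<close> has \<open>i\<close>-th degree 0, the sum of the two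
        degrees is their supremum.\<close>
      then have "deg \<Lambda> (\<mu> \<cdot> e) = sup (unit_deg i) (deg \<Lambda> \<mu>)"
        using \<mu> d0[OF i] by (auto simp: paths_from_def deg_Cmp fun_eq_iff unit_deg_def sup_max)
      then show False using no_ext[OF i, of e] e by (simp add: paths_from_def)
    qed
  qed
  ultimately show thesis using that \<mu> by blast
qed

text \<open>The path \<open>y\<close> starts with \<open>seg x (0, p)\<close>, has the degree of
  \<open>x\<close> on \<open>I\<close>, and degree at least \<open>n\<close> elsewhere. Hence
  \<open>x\<close> and \<open>y\<close> truncate degrees up to \<open>n\<close> alike and agree on
  the truncated segment.\<close>

lemma boundary_path_agrees_with_le_infty:
  assumes rf: "row_finite \<Lambda>" and x: "x \<in> boundary_paths \<Lambda>" and "m \<le> n"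
  shows "\<exists>y\<in>le_infty_paths \<Lambda>. bpath_rel \<Lambda> (x, (m, n)) (y, (m, n))"
proof -
  define p where "p = meet n (pdeg x)"
  define I where "I = {i. pdeg x i < enat (n i)}"
  define v where "v = vert x p"
  have xp: "x \<in> path_space \<Lambda>" using x by (simp add: boundary_paths_def)
  have p: "emb p \<le> pdeg x" by (simp add: p_def emb_meet)
  have pI: "enat (p i) = pdeg x i" if "i \<in> I" for i
    using that fun_cong[OF emb_meet[of n "pdeg x"], of i]
    by (auto simp: I_def p_def emb_def inf_min min_def)
  have pnI: "p i = n i" if "i \<notin> I" for i
    using that fun_cong[OF emb_meet[of n "pdeg x"], of i]
    by (auto simp: I_def p_def emb_def inf_min min_def not_less)
  have zero_le: "0 \<le> q" for q :: "'k \<Rightarrow> nat" by (simp add: le_fun_def)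
  have v: "v \<in> Obj \<Lambda>" using path_vert[OF xp p] by (simp add: v_def)
  define E where "E = (\<Union>i\<in>I. paths_from \<Lambda> v (unit_deg i))"
  have "finite E" using rf v by (auto simp: E_def row_finite_def)
  moreover have "E \<notin> FE \<Lambda> v"
  proof
    assume "E \<in> FE \<Lambda> v"
    then obtain q where q: "p \<le> q" "emb q \<le> pdeg x" "seg x (p, q) \<in> E"
      using x p unfolding boundary_paths_def v_def by blast
    then obtain i where i: "i \<in> I" "deg \<Lambda> (seg x (p, q)) = unit_deg i"
      by (auto simp: E_def paths_from_def)
    \<comment> \<open>The path \<open>x\<close> would take another step in direction
      \<open>i\<close>, although \<open>p i\<close> already equals \<open>pdeg x i\<close>.\<close>
    then have "q i - p i = 1"
      using path_spaceD(2)[OF xp q(1,2)] by (auto simp: unit_deg_def fun_eq_iff split: if_splits)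
    moreover have "q i \<le> p i"
      using le_funD[OF q(2), of i] pI[OF i(1)] by (metis emb_def enat_ord_simps(1))
    ultimately show False by simp
  qed
  ultimately have "\<not> exhaustive \<Lambda> v E" by (simp add: FE_def)
  then obtain \<mu> where \<mu>: "\<mu> \<in> Mor \<Lambda>" "Rng \<Lambda> \<mu> = v" "\<And>i. i \<in> I \<Longrightarrow> deg \<Lambda> \<mu> i = 0"
    "I \<subseteq> blocked (Src \<Lambda> \<mu>)"
    using nonexhaustive_edges[OF v] unfolding E_def by metis
  define h where "h = seg x (0, p)"
  have h: "h \<in> Mor \<Lambda>" "deg \<Lambda> h = p" "Src \<Lambda> h = Rng \<Lambda> \<mu>"
    using path_spaceD[OF xp zero_le p] \<mu>(2) by (auto simp: h_def v_def fun_eq_iff)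
  have h\<mu>: "h \<cdot> \<mu> \<in> Mor \<Lambda>" "deg \<Lambda> (h \<cdot> \<mu>) = p + deg \<Lambda> \<mu>" "Src \<Lambda> (h \<cdot> \<mu>) = Src \<Lambda> \<mu>"
    using h \<mu> by (auto simp: Cmp_closed deg_Cmp Src_Cmp)
  obtain y where y: "y \<in> le_infty_paths \<Lambda>" "emb (deg \<Lambda> (h \<cdot> \<mu>)) \<le> pdeg y"
    "seg y (0, deg \<Lambda> (h \<cdot> \<mu>)) = h \<cdot> \<mu>"
    "\<And>i. i \<in> blocked (Src \<Lambda> (h \<cdot> \<mu>)) \<Longrightarrow> pdeg y i = enat (deg \<Lambda> (h \<cdot> \<mu>) i)"
    using extend_to_le_infty[OF h\<mu>(1)] by blast
  have yp: "y \<in> path_space \<Lambda>" using y(1) by (simp add: le_infty_paths_def)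
  have y0p: "seg y (0, p) = seg x (0, p)"
    using path_seg_eqI(2)[OF yp zero_le y(2) h(1) \<mu>(1) h(3) y(3)] h by (simp add: h_def)
  \<comment> \<open>Neither \<open>\<mu>\<close> nor its continuation adds degree in the directions
    of \<open>I\<close>, so \<open>pdeg y i\<close> is still \<open>p i\<close>.\<close>
  have yI: "pdeg y i = pdeg x i" if "i \<in> I" for i
    using that y(4) \<mu>(3,4) h\<mu> pI by auto
  have ynI: "enat (n i) \<le> pdeg y i" if "i \<notin> I" for i
  proof -
    have "enat (n i) \<le> enat (p i + deg \<Lambda> \<mu> i)" using pnI[OF that] by simp
    also have "\<dots> \<le> pdeg y i" using le_funD[OF y(2), of i] h\<mu>(2) by (simp add: emb_def)
    finally show ?thesis .
  qed
  \<comment> \<open>On \<open>I\<close> the two path degrees coincide; off \<open>I\<close> both are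
    at least \<open>t\<close>, so neither truncates it.\<close>
  have meet_eq: "meet t (pdeg y) = meet t (pdeg x)" if "t \<le> n" for t
  proof
    fix i
    show "meet t (pdeg y) i = meet t (pdeg x) i"
    proof (cases "i \<in> I")
      case False
      have tn: "enat (t i) \<le> enat (n i)" using that by (simp add: le_fun_def)
      have "enat (n i) \<le> pdeg x i" using False by (simp add: I_def not_less)
      with tn have "enat (t i) \<le> pdeg x i" by (rule order_trans)
      moreover have "enat (t i) \<le> pdeg y i" using tn ynI[OF False] by (rule order_trans)
      ultimately show ?thesis by (simp add: meet_def min_absorb1)
    qed (simp add: meet_def yI)
  qed
  define m' where "m' = meet m (pdeg x)"
  have emb_le: "s \<le> t" if "emb s \<le> emb t" for s t :: "'k \<Rightarrow> nat"
    using that by (simp add: emb_def le_fun_def)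
  have "emb m \<le> emb n" using \<open>m \<le> n\<close> by (simp add: emb_def le_fun_def)
  then have m'p: "m' \<le> p"
    unfolding m'_def p_def by (intro emb_le) (simp add: emb_meet le_infI1)
  have py: "emb p \<le> pdeg y" using y(2) h\<mu>(2) by (intro emb_mono[OF _ y(2)]) (simp add: le_fun_def)
  \<comment> \<open>The common segment from 0 to \<open>p\<close> is cut at \<open>m'\<close>; the
    first factors have equal degree, so uniqueness also identifies the second ones.\<close>
  have "seg y (0, m') \<cdot> seg y (m', p) = seg x (0, m') \<cdot> seg x (m', p)"
    using trans[OF y0p path_seg_Cmp[OF xp zero_le m'p p]]
    unfolding path_seg_Cmp[OF yp zero_le m'p py] .
  moreover
  note x1 = path_spaceD[OF xp zero_le emb_mono[OF m'p p]] and x2 = path_spaceD[OF xp m'p p]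
    and y1 = path_spaceD[OF yp zero_le emb_mono[OF m'p py]] and y2 = path_spaceD[OF yp m'p py]
  ultimately have "seg y (m', p) = seg x (m', p)"
    using factor_unique(2)[OF y1(1) y2(1) trans[OF y1(4) y2(3)[symmetric]]
        x1(1) x2(1) trans[OF x1(4) x2(3)[symmetric]] _ trans[OF y1(2) x1(2)[symmetric]]]
    by blast
  then have "bpath_rel \<Lambda> (x, (m, n)) (y, (m, n))"
    using x le_infty_boundary[OF y(1)] \<open>m \<le> n\<close> meet_eq
    by (simp add: bpath_rel_def m'_def p_def)
  then show ?thesis using y(1) by blast
qed

end

theorem proposition4p12:
  fixes \<Lambda> :: "('o, 'm, 'k::finite) graded_cat"
    and x :: "('o, 'm, 'k) path"
    and m n :: "'k \<Rightarrow> nat"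
  assumes "kgraph \<Lambda>"
    and "row_finite \<Lambda>"
    and "x \<in> boundary_paths \<Lambda> - le_infty_paths \<Lambda>"
    and "m \<le> n"
  shows "\<exists>y\<in>le_infty_paths \<Lambda>. bpath_rel \<Lambda> (x, (m, n)) (y, (m, n))"
  using kgraph.boundary_path_agrees_with_le_infty[OF assms(1,2)] assms(3,4) by blast

end
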